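(* Let $a,N$ be positive integers and let $L\subseteq\{0,\dots,a-1\}$ be nonempty with $|L|=\ell$. Let $s_{L,N}$ and $S_{L,N}$ be the matrices with rows and columns indexed by $0\le n,k\le N$ and entries $$s_{L,N}(n,k)=\frac{(-1)^{n-k}}{\ell^n}\,\#\{\sigma\in C_a\wr S_n:\overleftarrow{\min}_L(\sigma)=k\},\qquad S_{L,N}(n,k)=\frac{1}{\ell^n}\,\#\{\sigma\in C_a\wr S_n: des_L(\sigma)=\overleftarrow{\min}_L(\sigma)=k\}.$$ Then $S_{L,N}^{-1}=s_{L,N}$.
   Context: Let $\alpha=e^{2\pi i/a}$ and $C_a=\{\alpha^t:0\le t\le a-1\}$. The wreath product $C_a\wr S_n$ is identified with the group of bijections $\sigma$ of $\{\alpha^v j: 0\le v\le a-1,\ 1\le j\le n\}$ satisfying $\sigma(\beta j)=\beta\sigma(j)$ for $\beta\in C_a$; we write $\sigma=[\sigma(1),\dots,\sigma(n)]$, $\sigma(j)=\alpha^{t_j}|\sigma(j)|$ with $|\sigma(j)|\in\{1,\dots,n\}$, $|\sigma|=[|\sigma(1)|,\dots,|\sigma(n)|]\in S_n$, and $\sigma(0)=0$. For $n=0$ the group is trivial and all statistics are $0$. $\overleftarrow{\mathrm{Min}}_L(\sigma)$ is the set of values $|\sigma(i)|$ which are right-to-left minima of $|\sigma|$ (i.e. $|\sigma(i)|<|\sigma(j)|$ for all $j>i$) and such that $\sigma(i)=\alpha^u|\sigma(i)|$ with $u\in L$; $\overleftarrow{\min}_L(\sigma)$ is its cardinality. The $L$-order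 $<_L$ on $\{\alpha^vj\}\cup\{0\}$, with $U$ the complement of $L$ in $\{0,\dots,a-1\}$: $\alpha^v j<_L 0$ if $v\in L$, $\alpha^v j>_L0$ if $v\in U$; for $u,v\in L$, $i\neq j$: $\alpha^v i<_L\alpha^u j$ iff $i>j$; for $u,v\in U$, $i\ne j$: $\alpha^v i<_L\alpha^u j$ iff $i<j$; ties with equal $j$ broken arbitrarily. $des_L(\sigma)=\#\{0\le i\le n-1:\sigma(i)>_L\sigma(i+1)\}$ with $\sigma(0)=0$. *)

theory Defs
  imports Complex_Main "HOL-Combinatorics.Permutations" "Jordan_Normal_Form.Matrix"
begin

definition alpha :: "nat \<Rightarrow> complex" where
  "alpha a = exp (2 * of_real pi * \<i> / of_nat a)"

definition C_grp :: "nat \<Rightarrow> complex set" where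
  "C_grp a = {alpha a ^ t | t. t < a}"

definition colored_pts :: "nat \<Rightarrow> nat \<Rightarrow> complex set" where
  "colored_pts a n = {alpha a ^ v * of_nat j | v j. v < a \<and> 1 \<le> j \<and> j \<le> n}"

text \<open>
  The bijections of the points \<open>\<alpha>\<^sup>v j\<close> commuting with the rotations by elements of \<open>C\<^sub>a\<close>.
  By the definition of \<open>permutes\<close> they are extended by the identity to all complex numbers,
  so that each bijection is counted once and \<open>\<sigma>(0) = 0\<close>.  Since \<open>|\<alpha>\<^sup>v j| = j\<close>, the
  underlying permutation \<open>|\<sigma>|\<close> is \<open>j \<mapsto> cmod (\<sigma> j)\<close>.
\<close>

definition wreath :: "nat \<Rightarrow> nat \<Rightarrow> (complex \<Rightarrow> complex) set" where
  "wreath a n = {\<sigma>. \<sigma> permutes colored_pts a n \<and>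
     (\<forall>\<beta>\<in>C_grp a. \<forall>j\<in>{1..n}. \<sigma> (\<beta> * of_nat j) = \<beta> * \<sigma> (of_nat j))}"

definition Min_RL :: "nat \<Rightarrow> nat set \<Rightarrow> nat \<Rightarrow> (complex \<Rightarrow> complex) \<Rightarrow> real set" where
  "Min_RL a L n \<sigma> = {cmod (\<sigma> (of_nat i)) | i. i \<in> {1..n} \<and>
     (\<forall>j\<in>{i<..n}. cmod (\<sigma> (of_nat i)) < cmod (\<sigma> (of_nat j))) \<and>
     (\<exists>u\<in>L. \<sigma> (of_nat i) = alpha a ^ u * of_real (cmod (\<sigma> (of_nat i))))}"

definition min_RL :: "nat \<Rightarrow> nat set \<Rightarrow> nat \<Rightarrow> (complex \<Rightarrow> complex) \<Rightarrow> nat" where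
  "min_RL a L n \<sigma> = card (Min_RL a L n \<sigma>)"

text \<open>
  Ties \<open>\<alpha>\<^sup>v j\<close> versus \<open>\<alpha>\<^sup>u j\<close> may be broken arbitrarily, so the \<open>L\<close>-order is not one relation:
  the predicate characterises all strict linear orders \<open>lt\<close> (read \<open>lt x y\<close> as \<open>x <\<^sub>L y\<close>) which
  are an \<open>L\<close>-order.  Elements with exponents on different sides of \<open>L\<close> are compared through 0.
\<close>

definition L_points :: "nat \<Rightarrow> complex set" where
  "L_points a = insert 0 {alpha a ^ v * of_nat j | v j. v < a \<and> 1 \<le> j}"

definition is_L_order :: "nat \<Rightarrow> nat set \<Rightarrow> (complex \<Rightarrow> complex \<Rightarrow> bool) \<Rightarrow> bool" where
  "is_L_order a L lt \<longleftrightarrow>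
     irreflp_on (L_points a) lt \<and> transp_on (L_points a) lt \<and> totalp_on (L_points a) lt \<and>
     (\<forall>v\<in>L. \<forall>j\<ge>1. lt (alpha a ^ v * of_nat j) 0) \<and>
     (\<forall>v\<in>{0..<a} - L. \<forall>j\<ge>1. lt 0 (alpha a ^ v * of_nat j)) \<and>
     (\<forall>u\<in>L. \<forall>v\<in>L. \<forall>i\<ge>1. \<forall>j\<ge>1. i \<noteq> j \<longrightarrow>
        (lt (alpha a ^ v * of_nat i) (alpha a ^ u * of_nat j) \<longleftrightarrow> i > j)) \<and>
     (\<forall>u\<in>{0..<a} - L. \<forall>v\<in>{0..<a} - L. \<forall>i\<ge>1. \<forall>j\<ge>1. i \<noteq> j \<longrightarrow>
        (lt (alpha a ^ v * of_nat i) (alpha a ^ u * of_nat j) \<longleftrightarrow> i < j))"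

definition des_L :: "(complex \<Rightarrow> complex \<Rightarrow> bool) \<Rightarrow> nat \<Rightarrow> (complex \<Rightarrow> complex) \<Rightarrow> nat" where
  "des_L lt n \<sigma> = card {i. i < n \<and> lt (\<sigma> (of_nat (i + 1))) (\<sigma> (of_nat i))}"

definition s_mat :: "nat \<Rightarrow> nat set \<Rightarrow> nat \<Rightarrow> rat mat" where
  "s_mat a L N = mat (N + 1) (N + 1) (\<lambda>(n, k).
     (-1) powi (int n - int k) / of_nat (card L) ^ n *
       of_nat (card {\<sigma> \<in> wreath a n. min_RL a L n \<sigma> = k}))"

definition S_mat :: "nat \<Rightarrow> nat set \<Rightarrow> (complex \<Rightarrow> complex \<Rightarrow> bool) \<Rightarrow> nat \<Rightarrow> rat mat" where
  "S_mat a L lt N = mat (N + 1) (N + 1) (\<lambda>(n, k).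
     1 / of_nat (card L) ^ n *
       of_nat (card {\<sigma> \<in> wreath a n. des_L lt n \<sigma> = k \<and> min_RL a L n \<sigma> = k}))"

text \<open>\<open>L\<close>-orders exist, so that a hypothesis \<open>is_L_order a L lt\<close> is never vacuous.\<close>

lemma cmod_alpha [simp]: "cmod (alpha a) = 1"
  by (simp add: alpha_def norm_exp_eq_Re)

lemma alpha_pow_inj:
  assumes "alpha a ^ u = alpha a ^ v" "u < a" "v < a"
  shows "u = v"
proof -
  have cis: "alpha a ^ k = cis (2 * pi * real k / real a)" for k
    by (simp add: alpha_def cis_conv_exp mult_ac flip: exp_of_nat_mult)
  have "inj_on (\<lambda>k. cis (2 * pi * real k / real a)) {..<a}"
    using bij_betw_roots_unity[of a] assms by (simp add: bij_betw_def)
  then show ?thesis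
    using assms unfolding cis by (auto dest: inj_onD)
qed

lemma ex_L_order:
  assumes "L \<subseteq> {0..<a}"
  shows "\<exists>lt. is_L_order a L lt"
proof -
  define k where "k x = (if \<exists>v\<in>L. x = alpha a ^ v * of_real (cmod x)
                         then - cmod x else cmod x)" for x
  define lt where "lt x y \<longleftrightarrow> k x < k y \<or> k x = k y \<and>
    (Re x < Re y \<or> Re x = Re y \<and> Im x < Im y)" for x y
  have kL: "k (alpha a ^ v * of_nat j) = - real j" if "v \<in> L" for v j
    using that by (auto simp: k_def norm_mult norm_power)
  have kU: "k (alpha a ^ v * of_nat j) = real j" if v: "v \<in> {0..<a} - L" and j: "j \<ge> 1" for v j
  proof -
    have "alpha a ^ v \<noteq> alpha a ^ u" if "u \<in> L" for u
      using that v assms alpha_pow_inj[of a v u] by auto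
    with j show ?thesis
      by (auto simp: k_def norm_mult norm_power)
  qed
  have k0: "k 0 = 0"
    by (simp add: k_def)
  have "irreflp_on (L_points a) lt" "transp_on (L_points a) lt"
    by (auto simp: irreflp_on_def transp_on_def lt_def)
  moreover have "totalp_on (L_points a) lt"
    by (auto simp: totalp_on_def lt_def complex_eq_iff)
  ultimately have "is_L_order a L lt"
    by (auto simp: is_L_order_def lt_def kL kU k0)
  then show ?thesis by blast
qed

end

theory Submission
  imports Defs "Jordan_Normal_Form.Determinant"
begin

text \<open>
  Deleting the letter of largest modulus \<open>n + 1\<close> from an element of \<open>C\<^sub>a \<wr> S\<^sub>n\<^sub>+\<^sub>1\<close> lowers
  \<open>min\<^sub>L\<close> exactly when that letter is last and coloured by \<open>L\<close>, and then it lowers \<open>des\<^sub>L\<close> too.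
  In the \<open>L\<close>-order the letter is extremal, so inserting it elsewhere preserves \<open>des\<^sub>L\<close> exactly
  when it splits a descent (for every colour) or is put last with a colour outside \<open>L\<close>. Hence
  \<open>min\<^sub>L \<le> des\<^sub>L\<close>, and the numbers \<open>c\<close> of elements with \<open>min\<^sub>L = k\<close> and \<open>d\<close> of those
  with \<open>des\<^sub>L = min\<^sub>L = k\<close> satisfy
  \<open>c(n + 1, k) = \<ell> c(n, k - 1) + (a (n + 1) - \<ell>) c(n, k)\<close> and
  \<open>d(n + 1, k) = \<ell> d(n, k - 1) + (a (k + 1) - \<ell>) d(n, k)\<close>.
  After the normalisation these are the recurrences of the Stirling numbers of both
  kinds with the same weights \<open>(a (k + 1) - \<ell>) / \<ell>\<close>, which form inverse matrices.
\<close>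

section \<open>Coloured words\<close>

text \<open>The letter \<open>(m, v)\<close> at position \<open>j\<close>, counted from 0, encodes
  sigma(j + 1) = alpha^v m, so a word is the one-line notation of a wreath product element.\<close>

definition words :: "nat \<Rightarrow> nat \<Rightarrow> (nat \<times> nat) list set" where
  "words a n = {w. distinct (map fst w) \<and> fst ` set w = {1..n} \<and> snd ` set w \<subseteq> {..<a}}"

definition insert_at :: "nat \<Rightarrow> 'a \<Rightarrow> 'a list \<Rightarrow> 'a list" where
  "insert_at p x w = take p w @ x # drop p w"

lemma length_words: "w \<in> words a n \<Longrightarrow> length w = n"
  by (auto simp: words_def dest!: distinct_card)

lemma fst_mem_words: "w \<in> words a n \<Longrightarrow> x \<in> set w \<Longrightarrow> fst x \<in> {1..n}"
  unfolding words_def by blast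

lemma words_nth:
  assumes "w \<in> words a n" "i < n"
  shows "fst (w ! i) \<in> {1..n}" "snd (w ! i) < a"
proof -
  have "w ! i \<in> set w"
    using assms length_words by auto
  then show "fst (w ! i) \<in> {1..n}" "snd (w ! i) < a"
    using assms(1) unfolding words_def by blast+
qed

lemma words_nth_eq_iff:
  assumes "w \<in> words a n" "i < n" "j < n"
  shows "fst (w ! i) = fst (w ! j) \<longleftrightarrow> i = j"
proof -
  have "distinct (map fst w)" "length w = n"
    using assms length_words by (auto simp: words_def)
  then show ?thesis
    using nth_eq_iff_index_eq[of "map fst w" i j] assms by simp
qed

lemma words_0: "words a 0 = {[]}"
  by (auto simp: words_def)

lemma finite_words: "finite (words a n)"
proof (rule finite_subset)
  show "words a n \<subseteq> {w. set w \<subseteq> {1..n} \<times> {..<a} \<and> length w = n}"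
  proof
    fix w assume w: "w \<in> words a n"
    have "set w \<subseteq> fst ` set w \<times> snd ` set w"
      by (rule subset_fst_snd)
    also have "\<dots> \<subseteq> {1..n} \<times> {..<a}"
      using w by (intro Sigma_mono) (auto simp: words_def)
    finally show "w \<in> {w. set w \<subseteq> {1..n} \<times> {..<a} \<and> length w = n}"
      using length_words[OF w] by simp
  qed
qed (simp add: finite_lists_length_eq)

text \<open>The modulus \<open>Suc n\<close> occurs exactly once in a word of length
  \<open>Suc n\<close>, so deleting that letter loses only its slot \<open>p\<close> and its colour
  \<open>v\<close>.\<close>

lemma bij_betw_insert_at:
  "bij_betw (\<lambda>(w, p, v). insert_at p (Suc n, v) w)
     (words a n \<times> {..n} \<times> {..<a}) (words a (Suc n))"
proof (rule bij_betw_imageI)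
  let ?f = "\<lambda>(w, p, v). insert_at p (Suc n, v) w"
  let ?P = "\<lambda>x::nat \<times> nat. fst x \<noteq> Suc n"
  show "inj_on ?f (words a n \<times> {..n} \<times> {..<a})"
  proof (rule inj_on_inverseI)
    fix x assume "x \<in> words a n \<times> {..n} \<times> {..<a}"
    then obtain w p v where x: "x = (w, p, v)" and w: "w \<in> words a n" and p: "p \<le> n"
      by auto
    have P: "?P x" if "x \<in> set w" for x
      using fst_mem_words[OF w that] by auto
    then have t: "\<forall>x\<in>set (take p w). ?P x" and d: "\<forall>x\<in>set (drop p w). ?P x"
      by (blast dest: in_set_takeD in_set_dropD)+
    have "filter ?P (take p w @ drop p w) = w"
      using P by (simp add: filter_id_conv)
    moreover have "length (take p w) = p"
      using length_words[OF w] p by simp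
    \<comment> \<open>The left inverse of insertion: filtering restores \<open>w\<close>, the prefix
      before the new letter measures \<open>p\<close>, and the letter after that prefix shows
      \<open>v\<close>.\<close>
    ultimately show "(\<lambda>w. (filter ?P w, length (takeWhile ?P w), snd (hd (dropWhile ?P w))))
      (?f x) = x"
      using t d by (simp add: x insert_at_def)
  qed
  show "?f ` (words a n \<times> {..n} \<times> {..<a}) = words a (Suc n)"
  proof (intro equalityI subsetI)
    fix w' assume "w' \<in> ?f ` (words a n \<times> {..n} \<times> {..<a})"
    then obtain w p v where w: "w \<in> words a n" and "p \<le> n" and v: "v < a"
      and w': "w' = insert_at p (Suc n, v) w"
      by auto
    have set: "set w' = insert (Suc n, v) (set w)"
      unfolding w' insert_at_def
      by (metis Un_insert_right append_take_drop_id list.simps(15) set_append)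
    have "mset (map fst w') = mset (Suc n # map fst w)"
      unfolding w' insert_at_def
      by simp (metis append_take_drop_id image_mset_union mset_append)
    moreover have "distinct (Suc n # map fst w)"
      using w by (auto simp: words_def)
    ultimately have "distinct (map fst w')"
      by (metis distinct_count_atmost_1 set_mset_mset)
    moreover have "fst ` set w' = {1..Suc n}" "snd ` set w' \<subseteq> {..<a}"
      using w v unfolding set words_def by auto
    ultimately show "w' \<in> words a (Suc n)"
      by (simp add: words_def)
  next
    fix w' assume w': "w' \<in> words a (Suc n)"
    then have "Suc n \<in> fst ` set w'"
      by (simp add: words_def)
    then obtain v where "(Suc n, v) \<in> set w'"
      by auto
    then obtain ys zs where eq: "w' = ys @ (Suc n, v) # zs"
      by (meson split_list)
    have d: "distinct (map fst (ys @ zs))" "Suc n \<notin> fst ` set (ys @ zs)"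
      using w' by (auto simp: words_def eq)
    have "insert (Suc n) (fst ` set (ys @ zs)) = insert (Suc n) {1..n}"
      using w' by (auto simp: words_def eq)
    then have "fst ` set (ys @ zs) = {1..n}"
      using d by (subst (asm) insert_ident) auto
    then have w: "ys @ zs \<in> words a n" and "v < a"
      using w' d by (auto simp: words_def eq)
    moreover have "length ys \<le> n"
      using length_words[OF w] by simp
    ultimately show "w' \<in> ?f ` (words a n \<times> {..n} \<times> {..<a})"
      by (intro image_eqI[of _ _ "(ys @ zs, length ys, v)"]) (simp_all add: insert_at_def eq)
  qed
qed

section \<open>The statistics under insertion of the largest letter\<close>

text \<open>An integer model of the L-order: colours in \<open>L\<close> lie below 0 with moduli
  reversed, the others above 0. Letters of equal modulus may share a key, but a word repeats no
  modulus.\<close>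

definition key :: "nat set \<Rightarrow> nat \<times> nat \<Rightarrow> int" where
  "key L x = (if snd x \<in> L then - int (fst x) else int (fst x))"

text \<open>The first argument is the entry preceding the list; starting it at 0 accounts for
  sigma(0) = 0.\<close>

fun des :: "int \<Rightarrow> int list \<Rightarrow> nat" where
  "des x [] = 0"
| "des x (y # ys) = of_bool (y < x) + des y ys"

fun mins :: "nat set \<Rightarrow> (nat \<times> nat) list \<Rightarrow> nat" where
  "mins L [] = 0"
| "mins L (x # w) = of_bool (snd x \<in> L \<and> (\<forall>y\<in>set w. fst x < fst y)) + mins L w"

text \<open>A descent is named by the slot between its two entries, with 0 put in front of the word,
  so \<open>insert_at p\<close> splits exactly the descent \<open>p\<close>.\<close>

definition descents :: "nat set \<Rightarrow> (nat \<times> nat) list \<Rightarrow> nat set" where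
  "descents L w = {p. p < length w \<and> map (key L) w ! p < (0 # map (key L) w) ! p}"

section \<open>Recursive statistics as cardinalities of position sets\<close>

lemma card_less_Suc_split:
  "card {i. i < Suc n \<and> P i} = of_bool (P 0) + card {i. i < n \<and> P (Suc i)}"
proof -
  have "{i. i < Suc n \<and> P i} = {i. i = 0 \<and> P i} \<union> Suc ` {i. i < n \<and> P (Suc i)}"
    by (auto simp: image_iff less_Suc_eq_0_disj)
  moreover have "card {i. i = 0 \<and> P i} = of_bool (P 0)"
    by (cases "P 0") (simp_all cong: conj_cong)
  ultimately show ?thesis
    by (subst \<open>{i. i < Suc n \<and> P i} = _\<close>, subst card_Un_disjoint) (auto simp: card_image)
qed

lemma des_eq_card: "des x ys = card {p. p < length ys \<and> ys ! p < (x # ys) ! p}"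
  by (induction ys arbitrary: x) (simp_all add: card_less_Suc_split)

lemma mins_eq_card:
  "mins L w = card {i. i < length w \<and> snd (w ! i) \<in> L \<and>
     (\<forall>j\<in>{i<..<length w}. fst (w ! i) < fst (w ! j))}"
proof (induction w)
  case (Cons x w)
  have "{0<..<Suc m} = Suc ` {..<m}" "{Suc i<..<Suc m} = Suc ` {i<..<m}" for i m
    by (auto simp: image_iff gr0_conv_Suc Suc_less_eq2)
  moreover have "(\<forall>j\<in>{..<length w}. fst x < fst (w ! j)) \<longleftrightarrow> (\<forall>y\<in>set w. fst x < fst y)"
    by (auto simp: all_set_conv_all_nth)
  ultimately show ?case
    by (simp add: card_less_Suc_split Cons.IH)
qed simp

text \<open>A new maximum is entered by an ascent and left by a descent. The latter is a gain unless
  it replaces a descent, and it is absent at the end of the list.\<close>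

lemma des_insert_greater:
  assumes "\<forall>y\<in>set (x # ys @ zs). y < M"
  shows "des x (ys @ M # zs) =
    des x (ys @ zs) + of_bool (zs \<noteq> [] \<and> \<not> hd zs < last (x # ys))"
  using assms by (induction ys arbitrary: x) (cases zs; force)+

text \<open>A new minimum is entered by a descent and left by an ascent, so the gain is cancelled
  only when a descent is split. At the end the gain always remains.\<close>

lemma des_insert_less:
  assumes "\<forall>y\<in>set (x # ys @ zs). M < y"
  shows "des x (ys @ M # zs) =
    des x (ys @ zs) + of_bool (zs = [] \<or> \<not> hd zs < last (x # ys))"
  using assms by (induction ys arbitrary: x) (cases zs; force)+

text \<open>The largest letter never stops an earlier one from being a right-to-left minimum, and is
  one itself only when no letter follows it.\<close>

lemma mins_insert:
  assumes "\<forall>y\<in>set (ys @ zs). fst y < fst M"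
  shows "mins L (ys @ M # zs) = mins L (ys @ zs) + of_bool (zs = [] \<and> snd M \<in> L)"
  using assms
proof (induction ys)
  case Nil
  then show ?case by (cases zs) auto
qed auto

lemma card_descents: "card (descents L w) = des 0 (map (key L) w)"
  by (simp add: descents_def des_eq_card)

lemma last_Cons_take: "p \<le> length w \<Longrightarrow> last (x # take p w) = (x # w) ! p"
  by (subst last_conv_nth) (simp_all add: min_absorb2 nth_Cons split: nat.split)

text \<open>The colour decides whether the new key is a minimum or a maximum. In an interior slot
  both cases give the same increment; they differ only at the end.\<close>

lemma des_insert_at:
  assumes w: "w \<in> words a n" and p: "p \<le> n"
  shows "des 0 (map (key L) (insert_at p (Suc n, v) w)) = des 0 (map (key L) w) +
    (if p = n then of_bool (v \<in> L) else of_bool (p \<notin> descents L w))"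
proof -
  let ?k = "map (key L)"
  have len: "length w = n"
    using length_words[OF w] .
  have bound: "\<bar>key L y\<bar> < int (Suc n)" if "y \<in> set w" for y
    using fst_mem_words[OF w that] by (simp add: key_def)
  have eq: "?k (insert_at p (Suc n, v) w) = take p (?k w) @ key L (Suc n, v) # drop p (?k w)"
    by (simp add: insert_at_def take_map drop_map)
  \<comment> \<open>The leading 0 is among the entries that the new key has to exceed or
    undercut.\<close>
  have all: "set (0 # take p (?k w) @ drop p (?k w)) = insert 0 (key L ` set w)"
    unfolding append_take_drop_id by simp
  have last: "last (0 # take p (?k w)) = (0 # ?k w) ! p"
    using p len by (intro last_Cons_take) simp
  have nil: "drop p (?k w) = [] \<longleftrightarrow> p = n"
    using p len by auto
  have desc: "p \<in> descents L w \<longleftrightarrow> hd (drop p (?k w)) < last (0 # take p (?k w))" if "p \<noteq> n"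
    using that p len unfolding last by (simp add: descents_def hd_drop_conv_nth)
  show ?thesis
  proof (cases "v \<in> L")
    case True
    then have "\<forall>y\<in>set (0 # take p (?k w) @ drop p (?k w)). key L (Suc n, v) < y"
      unfolding all using bound by (force simp: key_def abs_less_iff)
    from des_insert_less[OF this] show ?thesis
      using True desc unfolding eq nil append_take_drop_id by auto
  next
    case False
    then have "\<forall>y\<in>set (0 # take p (?k w) @ drop p (?k w)). y < key L (Suc n, v)"
      unfolding all using bound by (force simp: key_def abs_less_iff)
    from des_insert_greater[OF this] show ?thesis
      using False desc unfolding eq nil append_take_drop_id by auto
  qed
qed

lemma mins_insert_at:
  assumes w: "w \<in> words a n" and p: "p \<le> n"
  shows "mins L (insert_at p (Suc n, v) w) = mins L w + of_bool (p = n \<and> v \<in> L)"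
proof -
  have "fst y < Suc n" if "y \<in> set w" for y
    using fst_mem_words[OF w that] by simp
  then have "\<forall>y\<in>set (take p w @ drop p w). fst y < fst (Suc n, v)"
    by simp
  from mins_insert[OF this, of L] show ?thesis
    using p length_words[OF w] by (auto simp: insert_at_def)
qed

lemma words_Suc_cases:
  assumes "w' \<in> words a (Suc n)"
  obtains w p v where "w \<in> words a n" "p \<le> n" "v < a" "w' = insert_at p (Suc n, v) w"
  using assms unfolding bij_betw_imp_surj_on[OF bij_betw_insert_at[of n a], symmetric] by auto

text \<open>Every insertion that raises \<open>mins\<close> puts a letter coloured by
  \<open>L\<close> last, which also raises \<open>des\<close>.\<close>

lemma mins_le_des: "w \<in> words a n \<Longrightarrow> mins L w \<le> des 0 (map (key L) w)"
proof (induction n arbitrary: w)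
  case 0
  then show ?case by (simp add: words_0)
next
  case (Suc n)
  from Suc.prems obtain w0 p v where "w0 \<in> words a n" "p \<le> n" "w = insert_at p (Suc n, v) w0"
    by (rule words_Suc_cases)
  with Suc.IH[of w0] show ?case
    by (auto simp: des_insert_at mins_insert_at)
qed

section \<open>The recurrences\<close>

definition count_min :: "nat \<Rightarrow> nat set \<Rightarrow> nat \<Rightarrow> nat \<Rightarrow> nat" where
  "count_min a L n k = card {w \<in> words a n. mins L w = k}"

definition count_des_min :: "nat \<Rightarrow> nat set \<Rightarrow> nat \<Rightarrow> nat \<Rightarrow> nat" where
  "count_des_min a L n k =
     card {w \<in> words a n. des 0 (map (key L) w) = k \<and> mins L w = k}"

lemma card_filter_words_Suc:
  "card {w \<in> words a (Suc n). P w} =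
    (\<Sum>w\<in>words a n. card {(p, v). p \<le> n \<and> v < a \<and> P (insert_at p (Suc n, v) w)})"
proof -
  let ?f = "\<lambda>(w, p, v). insert_at p (Suc n, v) w"
  let ?F = "\<lambda>w. {(p, v). p \<le> n \<and> v < a \<and> P (insert_at p (Suc n, v) w)}"
  have "bij_betw ?f (Sigma (words a n) ?F) {w \<in> words a (Suc n). P w}"
  proof (rule bij_betw_imageI)
    show "inj_on ?f (Sigma (words a n) ?F)"
      by (rule inj_on_subset[OF bij_betw_imp_inj_on[OF bij_betw_insert_at[of n a]]]) auto
    show "?f ` Sigma (words a n) ?F = {w \<in> words a (Suc n). P w}"
      unfolding bij_betw_imp_surj_on[OF bij_betw_insert_at[of n a], symmetric] by force
  qed
  then have "card {w \<in> words a (Suc n). P w} = card (Sigma (words a n) ?F)"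
    by (simp add: bij_betw_same_card)
  also have "\<dots> = (\<Sum>w\<in>words a n. card (?F w))"
  proof (rule card_SigmaI)
    show "\<forall>w\<in>words a n. finite (?F w)"
      by (auto intro: finite_subset[of _ "{..n} \<times> {..<a}"])
  qed (rule finite_words)
  finally show ?thesis .
qed

lemma sum_of_bool_mult: "finite A \<Longrightarrow> (\<Sum>x\<in>A. of_bool (P x) * c) = card {x \<in> A. P x} * (c::nat)"
  by (simp add: of_bool_def if_distrib[of "\<lambda>x. x * c"] flip: sum.inter_filter cong: if_cong)

context
  fixes a :: nat and L :: "nat set"
  assumes L: "L \<subseteq> {..<a}"
begin

lemma card_compl_L: "card ({..<a} - L) = a - card L"
  using L by (simp add: card_Diff_subset finite_subset[OF L])

text \<open>Only the last slot with a colour in \<open>L\<close> raises \<open>mins\<close>. The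
  \<open>n\<close> interior slots with all \<open>a\<close> colours, and the last slot with the
  other \<open>a - card L\<close> colours, preserve it.\<close>

lemma card_extensions_min:
  assumes w: "w \<in> words a n"
  shows "card {(p, v). p \<le> n \<and> v < a \<and> mins L (insert_at p (Suc n, v) w) = k} =
    of_bool (Suc (mins L w) = k) * card L + of_bool (mins L w = k) * (a * n + (a - card L))"
    (is "card ?A = _")
proof -
  note ins = mins_insert_at[OF w]
  consider "mins L w = k" | "Suc (mins L w) = k" | "mins L w \<noteq> k" "Suc (mins L w) \<noteq> k"
    by blast
  then show ?thesis
  proof cases
    case 1
    then have "?A = {..<n} \<times> {..<a} \<union> {n} \<times> ({..<a} - L)"
      by (auto simp: ins)
    moreover have "card ({..<n} \<times> {..<a} \<union> {n} \<times> ({..<a} - L)) = a * n + (a - card L)"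
      by (subst card_Un_disjoint) (auto simp: card_compl_L card_cartesian_product)
    ultimately show ?thesis
      using 1 by simp
  next
    case 2
    then have "?A = {n} \<times> L"
      using L by (auto simp: ins of_bool_def split: if_splits)
    then show ?thesis
      using 2 by (simp add: card_cartesian_product)
  next
    case 3
    then have empty: "?A = {}"
      by (auto simp: ins)
    show ?thesis
      unfolding empty using 3 by auto
  qed
qed

text \<open>An interior slot preserves \<open>des\<close> only by splitting a descent. A word with
  \<open>des = k\<close> has \<open>k\<close> such slots, which puts \<open>a * k\<close> where the
  count for \<open>mins\<close> alone has \<open>a * n\<close>.\<close>

lemma card_extensions_des_min:
  assumes w: "w \<in> words a n"
  shows "card {(p, v). p \<le> n \<and> v < a \<and>
      des 0 (map (key L) (insert_at p (Suc n, v) w)) = k \<and> mins L (insert_at p (Suc n, v) w) = k} =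
    of_bool (Suc (des 0 (map (key L) w)) = k \<and> Suc (mins L w) = k) * card L +
    of_bool (des 0 (map (key L) w) = k \<and> mins L w = k) * (a * k + (a - card L))"
    (is "card ?A = _")
proof -
  let ?d = "des 0 (map (key L) w)" and ?m = "mins L w"
  note ins = mins_insert_at[OF w] des_insert_at[OF w]
  have le: "?m \<le> ?d"
    using w by (rule mins_le_des)
  have D: "descents L w \<subseteq> {..<n}"
    using length_words[OF w] by (auto simp: descents_def)
  consider "?d = k" "?m = k" | "Suc ?d = k" "Suc ?m = k"
    | "\<not> (?d = k \<and> ?m = k)" "\<not> (Suc ?d = k \<and> Suc ?m = k)"
    by blast
  then show ?thesis
  proof cases
    case 1
    then have "?A = descents L w \<times> {..<a} \<union> {n} \<times> ({..<a} - L)"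
      using D by (auto simp: ins of_bool_def split: if_splits)
    moreover have "card (descents L w \<times> {..<a} \<union> {n} \<times> ({..<a} - L)) = a * k + (a - card L)"
      using D 1 by (subst card_Un_disjoint)
        (auto simp: card_compl_L card_descents card_cartesian_product intro: finite_subset)
    ultimately show ?thesis
      using 1 by simp
  next
    case 2
    then have "?A = {n} \<times> L"
      using L by (auto simp: ins of_bool_def split: if_splits)
    then show ?thesis
      using 2 by (simp add: card_cartesian_product)
  next
    case 3
    \<comment> \<open>An interior insertion could raise \<open>des\<close> alone to match
      \<open>mins\<close>, but that would need \<open>mins\<close> to exceed \<open>des\<close>
      beforehand, which \<open>le\<close> excludes.\<close>
    then have empty: "?A = {}"
      using le by (auto simp: ins of_bool_def split: if_splits)
    show ?thesis
      unfolding empty using 3 by auto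
  qed
qed

text \<open>Writing \<open>Suc (mins L w) = k\<close> instead of \<open>mins L w = k - 1\<close>
  keeps the first term zero at \<open>k = 0\<close>, where truncated subtraction would not.\<close>

lemma count_min_Suc:
  "count_min a L (Suc n) k =
    card {w \<in> words a n. Suc (mins L w) = k} * card L + count_min a L n k * (a * n + (a - card L))"
proof -
  have "count_min a L (Suc n) k = (\<Sum>w\<in>words a n. of_bool (Suc (mins L w) = k) * card L +
      of_bool (mins L w = k) * (a * n + (a - card L)))"
    unfolding count_min_def card_filter_words_Suc by (intro sum.cong refl card_extensions_min)
  then show ?thesis
    unfolding count_min_def sum.distrib
    by (simp only: sum_of_bool_mult[OF finite_words])
qed

lemma count_des_min_Suc:
  "count_des_min a L (Suc n) k =
    card {w \<in> words a n. Suc (des 0 (map (key L) w)) = k \<and> Suc (mins L w) = k} * card L +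
    count_des_min a L n k * (a * k + (a - card L))"
proof -
  have "count_des_min a L (Suc n) k = (\<Sum>w\<in>words a n.
      of_bool (Suc (des 0 (map (key L) w)) = k \<and> Suc (mins L w) = k) * card L +
      of_bool (des 0 (map (key L) w) = k \<and> mins L w = k) * (a * k + (a - card L)))"
    unfolding count_des_min_def card_filter_words_Suc by (intro sum.cong refl card_extensions_des_min)
  then show ?thesis
    unfolding count_des_min_def sum.distrib
    by (simp only: sum_of_bool_mult[OF finite_words])
qed

lemma count_min_rec:
  "count_min a L 0 k = of_bool (k = 0)"
  "count_min a L (Suc n) 0 = count_min a L n 0 * (a * n + (a - card L))"
  "count_min a L (Suc n) (Suc k) =
    count_min a L n k * card L + count_min a L n (Suc k) * (a * n + (a - card L))"
proof -
  have "{w. w = [] \<and> mins L w = k} = (if k = 0 then {[]} else {})"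
    by auto
  then show "count_min a L 0 k = of_bool (k = 0)"
    by (simp add: count_min_def words_0)
qed (simp_all add: count_min_Suc, simp add: count_min_def)

lemma count_des_min_rec:
  "count_des_min a L 0 k = of_bool (k = 0)"
  "count_des_min a L (Suc n) 0 = count_des_min a L n 0 * (a - card L)"
  "count_des_min a L (Suc n) (Suc k) =
    count_des_min a L n k * card L + count_des_min a L n (Suc k) * (a * Suc k + (a - card L))"
proof -
  have "{w. w = [] \<and> des 0 (map (key L) w) = k \<and> mins L w = k} = (if k = 0 then {[]} else {})"
    by auto
  then show "count_des_min a L 0 k = of_bool (k = 0)"
    by (simp add: count_des_min_def words_0)
qed (simp_all add: count_des_min_Suc, simp add: count_des_min_def)

end

section \<open>Coloured words as elements of the wreath product\<close>

text \<open>For z = beta j with beta in the cyclic group, \<open>z / of_real (cmod z)\<close> is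
  beta and \<open>cmod z\<close> is j, so the letter at position j is rotated by beta. The
  \<open>- 1\<close> passes to list positions counted from 0.\<close>

definition act :: "nat \<Rightarrow> nat \<Rightarrow> (nat \<times> nat) list \<Rightarrow> complex \<Rightarrow> complex" where
  "act a n w z = (if z \<in> colored_pts a n then
     let (m, v) = w ! (nat \<lfloor>cmod z\<rfloor> - 1) in z / of_real (cmod z) * (alpha a ^ v * of_nat m)
     else z)"

section \<open>Polar form of the coloured points\<close>

lemma cmod_alpha_power_mult [simp]: "cmod (alpha a ^ t * of_nat j) = real j"
  by (simp add: norm_mult norm_power)

lemma alpha_nonzero [simp]: "alpha a \<noteq> 0"
  by (simp add: alpha_def)

lemma alpha_power_mod: "0 < a \<Longrightarrow> alpha a ^ (t mod a) = alpha a ^ t"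
proof -
  assume a: "0 < a"
  then have "alpha a ^ a = 1"
    by (simp add: alpha_def flip: exp_of_nat_mult)
  then have "alpha a ^ (a * (t div a) + t mod a) = alpha a ^ (t mod a)"
    by (simp only: power_add power_mult) simp
  then show ?thesis by simp
qed

lemma colored_ptsI: "0 < a \<Longrightarrow> j \<in> {1..n} \<Longrightarrow> alpha a ^ t * of_nat j \<in> colored_pts a n"
  unfolding colored_pts_def
  by (rule CollectI, rule exI[of _ "t mod a"], rule exI[of _ j]) (simp add: alpha_power_mod)

lemma colored_ptsE:
  assumes "z \<in> colored_pts a n"
  obtains t j where "t < a" "j \<in> {1..n}" "z = alpha a ^ t * of_nat j"
  using assms unfolding colored_pts_def by auto

lemma finite_colored_pts: "finite (colored_pts a n)"
proof (rule finite_subset)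
  show "colored_pts a n \<subseteq> (\<lambda>(v, j). alpha a ^ v * of_nat j) ` ({..<a} \<times> {1..n})"
    by (auto simp: colored_pts_def)
qed simp

lemma polar_eq_iff:
  assumes "1 \<le> i" "u < a" "v < a"
  shows "alpha a ^ u * of_nat i = alpha a ^ v * of_nat j \<longleftrightarrow> u = v \<and> i = j"
proof
  assume eq: "alpha a ^ u * of_nat i = alpha a ^ v * of_nat j"
  have "i = j"
    using arg_cong[OF eq, of cmod] by simp
  with eq assms show "u = v \<and> i = j"
    by (auto intro: alpha_pow_inj)
qed simp

lemma act_polar:
  assumes "0 < a" "j \<in> {1..n}"
  shows "act a n w (alpha a ^ t * of_nat j) =
    alpha a ^ t * (alpha a ^ snd (w ! (j - 1)) * of_nat (fst (w ! (j - 1))))"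
  using assms colored_ptsI[OF assms] by (simp add: act_def split: prod.split)

lemma act_of_nat:
  assumes "0 < a" "j \<in> {1..n}"
  shows "act a n w (of_nat j) = alpha a ^ snd (w ! (j - 1)) * of_nat (fst (w ! (j - 1)))"
  using act_polar[OF assms, of w 0] by simp

lemma act_0 [simp]: "act a n w 0 = 0"
  by (simp add: act_def split: prod.split)

text \<open>The modulus of an image determines the position; the common nonzero letter then cancels
  and leaves the rotation. Injectivity on the finite set of points gives bijectivity.\<close>

lemma act_in_wreath:
  assumes a: "0 < a" and w: "w \<in> words a n"
  shows "act a n w \<in> wreath a n"
proof -
  let ?C = "colored_pts a n"
  have into: "act a n w z \<in> ?C" if z: "z \<in> ?C" for z
  proof -
    obtain t j where "t < a" and j: "j \<in> {1..n}" and z: "z = alpha a ^ t * of_nat j"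
      using z by (rule colored_ptsE)
    then have "fst (w ! (j - 1)) \<in> {1..n}"
      by (intro words_nth[OF w]) auto
    from colored_ptsI[OF a this, of "t + snd (w ! (j - 1))"] show ?thesis
      unfolding z act_polar[OF a j] by (simp add: power_add mult.assoc)
  qed
  have inj: "inj_on (act a n w) ?C"
  proof (rule inj_onI)
    fix y z assume "y \<in> ?C" "z \<in> ?C" and eq: "act a n w y = act a n w z"
    obtain s i where "s < a" and i: "i \<in> {1..n}" and y: "y = alpha a ^ s * of_nat i"
      using \<open>y \<in> ?C\<close> by (rule colored_ptsE)
    obtain t j where "t < a" and j: "j \<in> {1..n}" and z: "z = alpha a ^ t * of_nat j"
      using \<open>z \<in> ?C\<close> by (rule colored_ptsE)
    note eq' = eq[unfolded y z act_polar[OF a i] act_polar[OF a j]]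
    have "fst (w ! (i - 1)) = fst (w ! (j - 1))"
      using arg_cong[OF eq', of cmod] by (simp add: norm_mult norm_power)
    then have "i - 1 = j - 1"
      using i j by (subst (asm) words_nth_eq_iff[OF w]) auto
    then have "i = j"
      using i j by auto
    moreover have "fst (w ! (j - 1)) \<in> {1..n}"
      using j by (intro words_nth[OF w]) auto
    ultimately show "y = z"
      using eq' by (simp add: y z)
  qed
  have "bij_betw (act a n w) ?C ?C"
    using inj into by (intro bij_betw_imageI endo_inj_surj finite_colored_pts) auto
  then have "act a n w permutes ?C"
    by (rule bij_imp_permutes) (simp add: act_def)
  moreover have "act a n w (\<beta> * of_nat j) = \<beta> * act a n w (of_nat j)"
    if "\<beta> \<in> C_grp a" "j \<in> {1..n}" for \<beta> j
    using that by (auto simp: C_grp_def act_polar[OF a] act_of_nat[OF a])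
  ultimately show ?thesis
    by (auto simp: wreath_def)
qed

lemma inj_on_act:
  assumes a: "0 < a"
  shows "inj_on (act a n) (words a n)"
proof (rule inj_onI)
  fix w w' assume w: "w \<in> words a n" and w': "w' \<in> words a n" and eq: "act a n w = act a n w'"
  show "w = w'"
  proof (rule nth_equalityI)
    show "length w = length w'"
      using w w' by (simp add: length_words)
    fix i assume "i < length w"
    then have i: "i < n"
      using w by (simp add: length_words)
    then have "alpha a ^ snd (w ! i) * of_nat (fst (w ! i)) =
        alpha a ^ snd (w' ! i) * of_nat (fst (w' ! i))"
      using fun_cong[OF eq, of "of_nat (Suc i)"] act_of_nat[OF a, of "Suc i" n] by simp
    then show "w ! i = w' ! i"
      using words_nth[OF w i] words_nth[OF w' i] by (auto simp: polar_eq_iff prod_eq_iff)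
  qed
qed

text \<open>Equivariance determines sigma from sigma(1), ..., sigma(n), whose polar forms are the
  letters. Their moduli are distinct because equal moduli would let sigma identify a rotation of one
  position with another position.\<close>

lemma wreath_eq_act:
  assumes a: "0 < a" and \<sigma>: "\<sigma> \<in> wreath a n"
  shows "\<exists>w\<in>words a n. \<sigma> = act a n w"
proof -
  have perm: "\<sigma> permutes colored_pts a n"
    using \<sigma> by (simp add: wreath_def)
  have equiv: "\<sigma> (alpha a ^ t * of_nat j) = alpha a ^ t * \<sigma> (of_nat j)"
    if "t < a" "j \<in> {1..n}" for t j
    using \<sigma> that by (auto simp: wreath_def C_grp_def)
  have "\<exists>x. snd x < a \<and> fst x \<in> {1..n} \<and> \<sigma> (of_nat j) = alpha a ^ snd x * of_nat (fst x)"
    if "j \<in> {1..n}" for j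
  proof -
    have "\<sigma> (of_nat j) \<in> colored_pts a n"
      using permutes_in_image[OF perm] colored_ptsI[OF a that, of 0] by simp
    then show ?thesis
      by (elim colored_ptsE) (metis fst_conv snd_conv)
  qed
  then obtain x where x: "snd (x j) < a" "fst (x j) \<in> {1..n}"
      "\<sigma> (of_nat j) = alpha a ^ snd (x j) * of_nat (fst (x j))" if "j \<in> {1..n}" for j
    by metis
  define w where "w = map x [1..<Suc n]"
  have "inj_on (\<lambda>j. fst (x j)) {1..n}"
  proof (rule inj_onI)
    fix i j assume i: "i \<in> {1..n}" and j: "j \<in> {1..n}" and eq: "fst (x i) = fst (x j)"
    \<comment> \<open>Rotate \<open>i\<close> so that its image acquires the colour of the image of \<open>j\<close>.\<close>
    define t where "t = (snd (x j) + (a - snd (x i))) mod a"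
    have "alpha a ^ t * alpha a ^ snd (x i) =
        alpha a ^ ((snd (x j) + (a - snd (x i)) + snd (x i)) mod a)"
      using a by (simp add: t_def alpha_power_mod power_add)
    also have "\<dots> = alpha a ^ snd (x j)"
      using x(1)[OF i] a by (simp add: alpha_power_mod)
    finally have "\<sigma> (alpha a ^ t * of_nat i) = \<sigma> (of_nat j)"
      using a eq by (simp add: equiv[OF _ i] x(3)[OF i] x(3)[OF j] t_def flip: mult.assoc)
    then have rot: "alpha a ^ t * of_nat i = of_nat j"
      using permutes_inj[OF perm] by (auto dest: injD)
    show "i = j"
      using arg_cong[OF rot, of cmod] by simp
  qed
  then have inj: "inj_on (fst \<circ> x) {1..n}"
    by (simp add: comp_def)
  have "set w = x ` {1..n}"
    by (auto simp: w_def)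
  moreover have "fst ` x ` {1..n} = {1..n}"
    unfolding image_comp using inj x(2) by (intro endo_inj_surj) auto
  moreover have "distinct (map fst w)"
    unfolding w_def map_map distinct_map using inj by (simp add: atLeastLessThanSuc_atLeastAtMost del: upt_Suc)
  ultimately have w: "w \<in> words a n"
    using x(1) by (auto simp: words_def)
  have nth: "w ! (j - 1) = x j" if "j \<in> {1..n}" for j
    using that nth_map_upt[of "j - 1" "Suc n" 1 x] by (auto simp: w_def simp del: upt_Suc)
  have "\<sigma> z = act a n w z" for z
  proof (cases "z \<in> colored_pts a n")
    case True
    then obtain t j where t: "t < a" and j: "j \<in> {1..n}" and z: "z = alpha a ^ t * of_nat j"
      by (rule colored_ptsE)
    show ?thesis
      unfolding z act_polar[OF a j] equiv[OF t j] nth[OF j] x(3)[OF j] ..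
  next
    case False
    then show ?thesis
      using permutes_not_in[OF perm] by (simp add: act_def)
  qed
  with w show ?thesis
    by blast
qed

lemma bij_betw_act: "0 < a \<Longrightarrow> bij_betw (act a n) (words a n) (wreath a n)"
  using act_in_wreath wreath_eq_act by (intro bij_betw_imageI inj_on_act) blast+

lemma card_filter_wreath:
  assumes "0 < a"
  shows "card {\<sigma> \<in> wreath a n. P \<sigma>} = card {w \<in> words a n. P (act a n w)}"
proof -
  note bij = bij_betw_act[OF assms, of n]
  have "{\<sigma> \<in> wreath a n. P \<sigma>} = act a n ` {w \<in> words a n. P (act a n w)}"
    unfolding bij_betw_imp_surj_on[OF bij, symmetric] by blast
  moreover have "inj_on (act a n) {w \<in> words a n. P (act a n w)}"
    by (rule inj_on_subset[OF bij_betw_imp_inj_on[OF bij]]) auto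
  ultimately show ?thesis
    by (simp add: card_image)
qed

section \<open>Transport of the right-to-left minima\<close>

lemma min_RL_act:
  assumes a: "0 < a" and L: "L \<subseteq> {..<a}" and w: "w \<in> words a n"
  shows "min_RL a L n (act a n w) = mins L w"
proof -
  let ?f = "\<lambda>i. real (fst (w ! i))"
  let ?I = "{i. i < n \<and> snd (w ! i) \<in> L \<and> (\<forall>j\<in>{i<..<n}. fst (w ! i) < fst (w ! j))}"
  have cmod: "cmod (act a n w (of_nat (Suc i))) = ?f i" if "i < n" for i
    using that act_of_nat[OF a, of "Suc i"] by simp
  have col: "(\<exists>u\<in>L. act a n w (of_nat (Suc i)) =
      alpha a ^ u * of_real (cmod (act a n w (of_nat (Suc i))))) \<longleftrightarrow> snd (w ! i) \<in> L"
    if i: "i < n" for i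
  proof -
    \<comment> \<open>Exponents below \<open>a\<close> are determined by the power of alpha, so the
      colour of a letter is well defined.\<close>
    have "act a n w (of_nat (Suc i)) = alpha a ^ u * of_real (cmod (act a n w (of_nat (Suc i))))
        \<longleftrightarrow> snd (w ! i) = u" if "u \<in> L" for u
      unfolding cmod[OF i] using act_of_nat[OF a, of "Suc i" n w] i that L words_nth[OF w i]
      by (auto simp: subset_iff intro: alpha_pow_inj)
    then show ?thesis by auto
  qed
  have ball: "(\<forall>j\<in>{Suc i<..n}. c < cmod (act a n w (of_nat j))) \<longleftrightarrow> (\<forall>j\<in>{i<..<n}. c < ?f j)"
    for i c
  proof -
    have "{Suc i<..n} = Suc ` {i<..<n}"
      by (auto simp: image_iff Suc_less_eq2 Suc_le_eq gr0_conv_Suc)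
    then show ?thesis
      using cmod by simp
  qed
  have "Min_RL a L n (act a n w) = ?f ` ?I"
  proof (intro equalityI subsetI)
    fix y assume "y \<in> Min_RL a L n (act a n w)"
    then obtain i where "i \<in> {1..n}"
      and y: "y = cmod (act a n w (of_nat i))"
      and less: "\<forall>j\<in>{i<..n}. cmod (act a n w (of_nat i)) < cmod (act a n w (of_nat j))"
      and L: "\<exists>u\<in>L. act a n w (of_nat i) = alpha a ^ u * of_real (cmod (act a n w (of_nat i)))"
      unfolding Min_RL_def by blast
    then obtain i' where i: "i = Suc i'" "i' < n"
      by (cases i) auto
    have "i' \<in> ?I"
      using less L i cmod[OF i(2)] unfolding i(1) ball col[OF i(2)] by simp
    moreover have "y = ?f i'"
      using y i cmod by simp
    ultimately show "y \<in> ?f ` ?I"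
      by blast
  next
    fix y assume "y \<in> ?f ` ?I"
    then obtain i where i: "i < n" and I: "i \<in> ?I" and y: "y = ?f i"
      by auto
    have "\<forall>j\<in>{Suc i<..n}. cmod (act a n w (of_nat (Suc i))) < cmod (act a n w (of_nat j))"
      unfolding ball cmod[OF i] using I by simp
    then show "y \<in> Min_RL a L n (act a n w)"
      unfolding Min_RL_def y using i I col[OF i] cmod[OF i]
      by (intro CollectI exI[of _ "Suc i"]) auto
  qed
  \<comment> \<open>\<open>Min_RL\<close> collects values while \<open>mins\<close> counts
    positions; distinct moduli make the two cardinalities agree.\<close>
  moreover have "inj_on ?f ?I"
    by (rule inj_onI) (simp add: words_nth_eq_iff[OF w])
  ultimately have "min_RL a L n (act a n w) = card ?I"
    by (simp add: min_RL_def card_image)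
  then show ?thesis
    by (simp add: mins_eq_card length_words[OF w])
qed

section \<open>L-orders compared with integer keys\<close>

lemma lt_0_iff_key:
  assumes lt: "is_L_order a L lt" and "v < a" "1 \<le> i"
  shows "lt (alpha a ^ v * of_nat i) 0 \<longleftrightarrow> key L (i, v) < 0"
proof (cases "v \<in> L")
  case True
  then show ?thesis
    using assms by (auto simp: is_L_order_def key_def)
next
  case False
  have pts: "0 \<in> L_points a" "alpha a ^ v * of_nat i \<in> L_points a"
    using assms by (auto simp: L_points_def)
  have "lt 0 (alpha a ^ v * of_nat i)"
    using assms False by (auto simp: is_L_order_def)
  moreover have "irreflp_on (L_points a) lt" "transp_on (L_points a) lt"
    using lt by (simp_all add: is_L_order_def)
  ultimately have "\<not> lt (alpha a ^ v * of_nat i) 0"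
    using pts by (meson irreflp_onD transp_onD)
  then show ?thesis
    using False by (simp add: key_def)
qed

text \<open>Distinct moduli exclude the arbitrary ties, and letters on different sides of
  \<open>L\<close> are compared through 0 by transitivity.\<close>

lemma lt_iff_key:
  assumes lt: "is_L_order a L lt" and "v < a" "u < a" "1 \<le> i" "1 \<le> j" "i \<noteq> j"
  shows "lt (alpha a ^ v * of_nat i) (alpha a ^ u * of_nat j) \<longleftrightarrow> key L (i, v) < key L (j, u)"
proof -
  let ?x = "alpha a ^ v * of_nat i" and ?y = "alpha a ^ u * of_nat j"
  have pts: "0 \<in> L_points a" "?x \<in> L_points a" "?y \<in> L_points a"
    using assms by (auto simp: L_points_def)
  have irr: "irreflp_on (L_points a) lt" and tr: "transp_on (L_points a) lt"
    using lt by (simp_all add: is_L_order_def)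
  consider "v \<in> L" "u \<in> L" | "v \<notin> L" "u \<notin> L" | "v \<in> L" "u \<notin> L" | "v \<notin> L" "u \<in> L"
    by blast
  then show ?thesis
  proof cases
    case 3
    then have "lt ?x 0" "lt 0 ?y"
      using assms by (auto simp: is_L_order_def)
    then have "lt ?x ?y"
      using pts tr by (meson transp_onD)
    then show ?thesis
      using 3 assms by (simp add: key_def)
  next
    case 4
    then have "lt 0 ?x" "lt ?y 0"
      using assms by (auto simp: is_L_order_def)
    then have "\<not> lt ?x ?y"
      using pts irr tr by (meson irreflp_onD transp_onD)
    then show ?thesis
      using 4 assms by (simp add: key_def)
  qed (use assms in \<open>simp_all add: is_L_order_def key_def\<close>)
qed

text \<open>Adjacent letters of a word have distinct moduli and the first letter is compared with
  sigma(0) = 0, so only comparisons on which all L-orders agree occur.\<close>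

lemma des_L_act:
  assumes a: "0 < a" and lt: "is_L_order a L lt" and w: "w \<in> words a n"
  shows "des_L lt n (act a n w) = des 0 (map (key L) w)"
proof -
  have len: "length w = n"
    using length_words[OF w] .
  have "lt (act a n w (of_nat (i + 1))) (act a n w (of_nat i)) \<longleftrightarrow>
      map (key L) w ! i < (0 # map (key L) w) ! i" if i: "i < n" for i
  proof -
    have act: "act a n w (of_nat (Suc j)) = alpha a ^ snd (w ! j) * of_nat (fst (w ! j))"
      if "j < n" for j
      using that act_of_nat[OF a, of "Suc j"] by simp
    show ?thesis
    proof (cases i)
      case 0
      then show ?thesis
        using i len act[OF i] lt_0_iff_key[OF lt] words_nth[OF w i] by simp
    next
      case (Suc j)
      then have "fst (w ! i) \<noteq> fst (w ! j)"
        using i words_nth_eq_iff[OF w] by simp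
      then show ?thesis
        using i len act[OF i] act[of j] words_nth[OF w i] words_nth[OF w, of j] Suc
          lt_iff_key[OF lt, of "snd (w ! i)" "snd (w ! j)" "fst (w ! i)" "fst (w ! j)"]
        by simp
    qed
  qed
  then show ?thesis
    unfolding des_L_def des_eq_card using len by (auto intro!: arg_cong[of _ _ card])
qed

section \<open>Matrix entries as counts of words\<close>

lemma card_wreath_min:
  assumes "0 < a" "L \<subseteq> {..<a}"
  shows "card {\<sigma> \<in> wreath a n. min_RL a L n \<sigma> = k} = count_min a L n k"
  unfolding count_min_def card_filter_wreath[OF assms(1)]
  using min_RL_act[OF assms] by (auto intro!: arg_cong[of _ _ card])

lemma card_wreath_des_min:
  assumes "0 < a" "L \<subseteq> {..<a}" "is_L_order a L lt"
  shows "card {\<sigma> \<in> wreath a n. des_L lt n \<sigma> = k \<and> min_RL a L n \<sigma> = k} = count_des_min a L n k"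
  unfolding count_des_min_def card_filter_wreath[OF assms(1)]
  using min_RL_act[OF assms(1,2)] des_L_act[OF assms(1,3)] by (auto intro!: arg_cong[of _ _ card])

section \<open>Inverse triangular arrays\<close>

text \<open>With p_n = (x - r 0) ... (x - r (n - 1)), the \<open>s n k\<close> expand p_n in powers
  of x and the \<open>S k m\<close> expand x^k in the p_m, so the two arrays are opposite changes of
  basis. The bound \<open>n \<le> K\<close> keeps all of row \<open>n\<close> of \<open>s\<close>
  inside the sum.\<close>

lemma inverse_triangular_recurrences:
  fixes s S :: "nat \<Rightarrow> nat \<Rightarrow> 'a::comm_ring_1" and r :: "nat \<Rightarrow> 'a"
  assumes s: "\<And>k. s 0 k = of_bool (k = 0)"
      "\<And>n. s (Suc n) 0 = - r n * s n 0"
      "\<And>n k. s (Suc n) (Suc k) = s n k - r n * s n (Suc k)"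
    and S: "\<And>k. S 0 k = of_bool (k = 0)"
      "\<And>n. S (Suc n) 0 = r 0 * S n 0"
      "\<And>n k. S (Suc n) (Suc k) = S n k + r (Suc k) * S n (Suc k)"
    and "n \<le> K"
  shows "(\<Sum>k\<le>K. s n k * S k m) = of_bool (n = m)"
  using \<open>n \<le> K\<close>
proof (induction n arbitrary: m)
  case 0
  then show ?case
    by (simp add: s S of_bool_def if_distrib[of "\<lambda>x. x * _"] cong: if_cong)
next
  case (Suc n)
  have zero: "s n k = 0" if "n < k" for n k
    using that
  proof (induction n arbitrary: k)
    case (Suc n)
    then show ?case by (cases k) (auto simp: s)
  qed (simp add: s)
  have IH: "(\<Sum>k\<le>K. s n k * S k m) = of_bool (n = m)" for m
    using Suc by simp
  obtain K' where K: "K = Suc K'"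
    using Suc.prems by (cases K) auto
  have "(\<Sum>k\<le>K. s (Suc n) k * S k m) =
      (\<Sum>k\<le>K'. s n k * S (Suc k) m) - r n * (\<Sum>k\<le>K. s n k * S k m)"
    unfolding K sum.atMost_Suc_shift
    by (simp add: s algebra_simps sum_distrib_left sum_subtractf)
  \<comment> \<open>The added term at \<open>k = K\<close> vanishes: \<open>s n K = 0\<close>
    because \<open>n < K\<close>.\<close>
  also have "(\<Sum>k\<le>K'. s n k * S (Suc k) m) = (\<Sum>k\<le>K. s n k * S (Suc k) m)"
    using Suc.prems by (simp add: K zero)
  also have "\<dots> - r n * (\<Sum>k\<le>K. s n k * S k m) = of_bool (Suc n = m)"
  \<comment> \<open>The recurrence of \<open>S\<close> and the induction hypothesis leave
    \<open>r m - r n\<close> at \<open>n = m\<close>, which is zero, and 1 at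
    \<open>Suc n = m\<close>.\<close>
  proof (cases m)
    case 0
    have "(\<Sum>k\<le>K. s n k * S (Suc k) 0) = r 0 * (\<Sum>k\<le>K. s n k * S k 0)"
      by (simp add: S sum_distrib_left mult_ac)
    then show ?thesis
      by (simp add: 0 IH)
  next
    case (Suc m')
    have "(\<Sum>k\<le>K. s n k * S (Suc k) (Suc m')) =
        (\<Sum>k\<le>K. s n k * S k m') + r (Suc m') * (\<Sum>k\<le>K. s n k * S k (Suc m'))"
      by (simp add: S sum_distrib_left sum.distrib algebra_simps)
    then show ?thesis
      by (simp add: Suc IH)
  qed
  finally show ?case .
qed

theorem theorem1p2:
  fixes a N :: nat and L :: "nat set" and lt :: "complex \<Rightarrow> complex \<Rightarrow> bool"
  assumes "a > 0" and "N > 0"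
    and "L \<subseteq> {0..a - 1}" and "L \<noteq> {}"
    and "is_L_order a L lt"
  shows "inverts_mat (S_mat a L lt N) (s_mat a L N) \<and> inverts_mat (s_mat a L N) (S_mat a L lt N)"
proof -
  let ?l = "of_nat (card L) :: rat"
  \<comment> \<open>The exponent is negative above the diagonal. Raising either index by one flips
    the sign, and raising both preserves it.\<close>
  define e :: "nat \<Rightarrow> nat \<Rightarrow> rat" where "e n k = (-1) powi (int n - int k)" for n k
  define s where "s n k = e n k / ?l ^ n * of_nat (count_min a L n k)" for n k
  define S where "S n k = 1 / ?l ^ n * of_nat (count_des_min a L n k)" for n k
  \<comment> \<open>The weight shared by both arrays: dividing by one more factor \<open>?l\<close>
    turns the coefficient \<open>card L\<close> into 1 and the other one into \<open>r\<close>,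
    taken at the row for \<open>s\<close> and at the column for \<open>S\<close>.\<close>
  define r where "r k = of_nat (a * k + (a - card L)) / ?l" for k
  have L: "L \<subseteq> {..<a}"
    using assms by force
  then have l: "?l \<noteq> 0"
    using assms finite_subset by fastforce
  have e: "e 0 0 = 1" "e (Suc n) k = - e n k" "e n (Suc k) = - e n k" for n k
    using power_int_add_1[of "-1::rat" "int n - int k"]
      power_int_add_1[of "-1::rat" "int n - int (Suc k)"]
    by (simp_all add: e_def algebra_simps)
  have smat: "s_mat a L N = mat (N + 1) (N + 1) (\<lambda>(n, k). s n k)"
    unfolding s_mat_def s_def e_def card_wreath_min[OF \<open>a > 0\<close> L] ..
  have Smat: "S_mat a L lt N = mat (N + 1) (N + 1) (\<lambda>(n, k). S n k)"
    unfolding S_mat_def S_def card_wreath_des_min[OF \<open>a > 0\<close> L \<open>is_L_order a L lt\<close>] ..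
  have s_rec: "s 0 k = of_bool (k = 0)" "s (Suc n) 0 = - r n * s n 0"
    "s (Suc n) (Suc k) = s n k - r n * s n (Suc k)" for n k
    using l unfolding s_def r_def count_min_rec[OF L] by (simp_all add: e field_simps, cases k, simp_all add: e)
  have S_rec: "S 0 k = of_bool (k = 0)" "S (Suc n) 0 = r 0 * S n 0"
    "S (Suc n) (Suc k) = S n k + r (Suc k) * S n (Suc k)" for n k
    using l unfolding S_def r_def count_des_min_rec[OF L] by (simp_all add: field_simps)
  have carrier: "s_mat a L N \<in> carrier_mat (N + 1) (N + 1)" "S_mat a L lt N \<in> carrier_mat (N + 1) (N + 1)"
    by (simp_all add: smat Smat)
  have "s_mat a L N * S_mat a L lt N = 1\<^sub>m (N + 1)"
  proof (rule eq_matI)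
    fix i j assume "i < dim_row (1\<^sub>m (N + 1) :: rat mat)" "j < dim_col (1\<^sub>m (N + 1) :: rat mat)"
    then have ij: "i < N + 1" "j < N + 1"
      by auto
    then have "(s_mat a L N * S_mat a L lt N) $$ (i, j) = (\<Sum>k\<in>{0..<N + 1}. s i k * S k j)"
      by (simp add: smat Smat scalar_prod_def)
    also have "{0..<N + 1} = {..N}"
      by auto
    also have "(\<Sum>k\<le>N. s i k * S k j) = of_bool (i = j)"
      using ij by (intro inverse_triangular_recurrences[where r = r] s_rec S_rec) simp
    finally show "(s_mat a L N * S_mat a L lt N) $$ (i, j) = 1\<^sub>m (N + 1) $$ (i, j)"
      using ij by simp
  qed (simp_all add: smat Smat)
  \<comment> \<open>For square matrices over a field a one-sided inverse is two-sided, so one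
    product suffices.\<close>
  then show ?thesis
    using mat_mult_left_right_inverse[OF carrier] carrier by (simp add: inverts_mat_def)
qed

end
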